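(* Let $I \subset S=\mathbb{K}[x_1,\ldots,x_n]$ be a stable monomial ideal. Then $$\mathrm{sat}(I)=\max\{\ell : x_n^{\ell}\mid u\ \text{ for some }u\in \mathcal{G}(I)\}.$$
   Context: $\mathbb{K}$ is a field, $S=\mathbb{K}[x_1,\ldots,x_n]$ is the polynomial ring and $\mathfrak{m}=(x_1,\ldots,x_n)$. For ideals $I,J$ of $S$, $I\colon J=\{f\in S : fJ\subseteq I\}$, and $\mathfrak{m}^0=S$. The saturation number of an ideal $I\subset S$ is $\mathrm{sat}(I)=\min\{k\geq 0 : I\colon\mathfrak{m}^k=I\colon\mathfrak{m}^{k+1}\}$. $\mathcal{G}(I)$ denotes the unique set of minimal monomial generators of a monomial ideal $I$. For a monomial $u\in S$, $m(u)$ is the maximal number $j$ such that $x_j\mid u$. A monomial ideal $I$ is stable if for all $u\in\mathcal{G}(I)$ and all $i<m(u)$ one has $x_iu/x_{m(u)}\in I$. *)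

theory Defs
  imports "HOL-Algebra.Ideal_Product" "HOL-Algebra.Divisibility" "HOL-Library.Poly_Mapping"
begin

text \<open>
  A polynomial is a finitely supported map from exponent vectors to coefficients, and an exponent
  vector is a finitely supported map from variable indices to exponents. The ring
  \<open>K[x\<^sub>1, \<dots>, x\<^sub>n]\<close> consists of the polynomials in which only variables with index in
  \<open>{1..n}\<close> occur; the coefficient field is the type \<open>'k\<close>.
\<close>

type_synonym 'k mpoly = "(nat \<Rightarrow>\<^sub>0 nat) \<Rightarrow>\<^sub>0 'k"

definition mpoly_ring :: "nat \<Rightarrow> 'k::field mpoly ring" where
  "mpoly_ring n =
    \<lparr>carrier = {p. \<forall>a\<in>Poly_Mapping.keys p. Poly_Mapping.keys a \<subseteq> {1..n}},
     monoid.mult = (*), one = 1, zero = 0, add = (+)\<rparr>"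

lemma cring_mpoly_ring: "cring (mpoly_ring n :: 'k::field mpoly ring)"
proof (rule cringI)
  show "abelian_group (mpoly_ring n :: 'k mpoly ring)"
  proof (rule abelian_groupI)
    fix p :: "'k mpoly"
    assume "p \<in> carrier (mpoly_ring n)"
    then show "\<exists>q\<in>carrier (mpoly_ring n). q \<oplus>\<^bsub>mpoly_ring n\<^esub> p = \<zero>\<^bsub>mpoly_ring n\<^esub>"
      by (intro bexI[of _ "- p"]) (auto simp: mpoly_ring_def)
  next
    fix p q :: "'k mpoly"
    assume "p \<in> carrier (mpoly_ring n)" "q \<in> carrier (mpoly_ring n)"
    then show "p \<oplus>\<^bsub>mpoly_ring n\<^esub> q \<in> carrier (mpoly_ring n)"
      using keys_add[of p q] by (fastforce simp: mpoly_ring_def)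
  qed (auto simp: mpoly_ring_def algebra_simps)
  show "comm_monoid (mpoly_ring n :: 'k mpoly ring)"
  proof (rule comm_monoidI)
    fix p q :: "'k mpoly"
    assume pq: "p \<in> carrier (mpoly_ring n)" "q \<in> carrier (mpoly_ring n)"
    have "Poly_Mapping.keys c \<subseteq> {1..n}" if c: "c \<in> Poly_Mapping.keys (p * q)" for c
    proof -
      obtain a b where "c = a + b" "a \<in> Poly_Mapping.keys p" "b \<in> Poly_Mapping.keys q"
        using c keys_mult[of p q] by blast
      with pq keys_add[of a b] show ?thesis
        by (auto simp: mpoly_ring_def dest!: subsetD)
    qed
    then show "p \<otimes>\<^bsub>mpoly_ring n\<^esub> q \<in> carrier (mpoly_ring n)"
      by (auto simp: mpoly_ring_def)
  qed (auto simp: mpoly_ring_def algebra_simps)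
qed (auto simp: mpoly_ring_def algebra_simps)

definition var :: "nat \<Rightarrow> 'k::field mpoly" where
  "var i = Poly_Mapping.single (Poly_Mapping.single i 1) 1"

definition monomials :: "nat \<Rightarrow> 'k::field mpoly set" where
  "monomials n = {Poly_Mapping.single a 1 | a. Poly_Mapping.keys a \<subseteq> {1..n}}"

definition max_ideal :: "nat \<Rightarrow> 'k::field mpoly set" where
  "max_ideal n = Idl\<^bsub>mpoly_ring n\<^esub> (var ` {1..n})"

definition colon_ideal :: "('a, 'b) ring_scheme \<Rightarrow> 'a set \<Rightarrow> 'a set \<Rightarrow> 'a set" where
  "colon_ideal R I J = {f \<in> carrier R. \<forall>g\<in>J. f \<otimes>\<^bsub>R\<^esub> g \<in> I}"

text \<open>Powers are taken in the multiplicative monoid of ideals, whose unit is the whole ring.\<close>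

definition sat :: "nat \<Rightarrow> 'k::field mpoly set \<Rightarrow> nat" where
  "sat n I = (LEAST k.
     colon_ideal (mpoly_ring n) I (max_ideal n [^]\<^bsub>ideals_set (mpoly_ring n)\<^esub> k) =
     colon_ideal (mpoly_ring n) I (max_ideal n [^]\<^bsub>ideals_set (mpoly_ring n)\<^esub> (k + 1)))"

definition monomial_ideal :: "nat \<Rightarrow> 'k::field mpoly set \<Rightarrow> bool" where
  "monomial_ideal n I \<longleftrightarrow> (\<exists>M \<subseteq> monomials n. I = Idl\<^bsub>mpoly_ring n\<^esub> M)"

definition min_gens :: "nat \<Rightarrow> 'k::field mpoly set \<Rightarrow> 'k mpoly set" where
  "min_gens n I = (THE G. G \<subseteq> monomials n \<and> Idl\<^bsub>mpoly_ring n\<^esub> G = I \<and>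
     (\<forall>H. H \<subset> G \<longrightarrow> Idl\<^bsub>mpoly_ring n\<^esub> H \<noteq> I))"

text \<open>
  On \<open>nat\<close>, \<open>Sup\<close> is \<open>Max\<close> with the value \<open>0\<close> on the empty set; hence
  \<open>max_var n 1 = 0\<close>, and the constant monomial imposes no condition in \<open>stable_ideal\<close>.
  With the same convention, a maximum over the generators of the zero ideal is \<open>0\<close>.
\<close>

definition max_var :: "nat \<Rightarrow> 'k::field mpoly \<Rightarrow> nat" where
  "max_var n u = Sup {j \<in> {1..n}. var j divides\<^bsub>mpoly_ring n\<^esub> u}"

text \<open>The element \<open>v\<close> below is the quotient \<open>x\<^sub>i u / x\<^sub>m\<close> with \<open>m = max_var n u\<close>.\<close>

definition stable_ideal :: "nat \<Rightarrow> 'k::field mpoly set \<Rightarrow> bool" where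
  "stable_ideal n I \<longleftrightarrow> monomial_ideal n I \<and>
     (\<forall>u\<in>min_gens n I. \<forall>i\<in>{1..<max_var n u}. \<exists>v\<in>I.
        v \<otimes>\<^bsub>mpoly_ring n\<^esub> var (max_var n u) = var i \<otimes>\<^bsub>mpoly_ring n\<^esub> u)"

end

(* Let E be the set of exponent vectors of the monomials in I. Stability lets one factor x_n of a
   monomial of I be replaced by any x_i, so I : m^k = I : x_n^k; both are spanned by the monomials
   x^a with a + k e_n in E. If k bounds the x_n-exponents of the minimal generators, then
   a + (k+1) e_n in E forces a + k e_n in E, since a generator dividing x_n^(k+1) x^a already
   divides x_n^k x^a. If some generator is x_n^(k+1) x^a, then x_n^k x^a is not in I by minimality.
   Dickson's lemma makes the maximum on the right-hand side finite. *)

theory Submission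
  imports Defs Complex_Main
begin

section \<open>Encoding of monomials and monomial ideals by exponent vectors\<close>

definition exps :: "nat \<Rightarrow> (nat \<Rightarrow>\<^sub>0 nat) set" where
  "exps n = {a. Poly_Mapping.keys a \<subseteq> {1..n}}"

definition mon :: "(nat \<Rightarrow>\<^sub>0 nat) \<Rightarrow> 'k::field mpoly" where
  "mon a = Poly_Mapping.single a 1"

text \<open>The K-span of the monomials x^a with a in \<open>E\<close>. All ideals below take this
  form, so that operations on ideals become operations on sets of exponents.\<close>

definition poly_on :: "(nat \<Rightarrow>\<^sub>0 nat) set \<Rightarrow> 'k::field mpoly set" where
  "poly_on E = {p. Poly_Mapping.keys p \<subseteq> E}"

definition edvd :: "(nat \<Rightarrow>\<^sub>0 nat) \<Rightarrow> (nat \<Rightarrow>\<^sub>0 nat) \<Rightarrow> bool" where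
  "edvd a b \<longleftrightarrow> (\<forall>i. Poly_Mapping.lookup a i \<le> Poly_Mapping.lookup b i)"

definition deg :: "nat \<Rightarrow> (nat \<Rightarrow>\<^sub>0 nat) \<Rightarrow> nat" where
  "deg n a = (\<Sum>i\<in>{1..n}. Poly_Mapping.lookup a i)"

text \<open>The exponents of the monomials in the ideal generated by the x^m with m in
  \<open>A\<close>; see \<open>genideal_mon\<close>.\<close>

definition upset :: "nat \<Rightarrow> (nat \<Rightarrow>\<^sub>0 nat) set \<Rightarrow> (nat \<Rightarrow>\<^sub>0 nat) set" where
  "upset n A = {a \<in> exps n. \<exists>m\<in>A. edvd m a}"

text \<open>For an up-set \<open>E\<close> these are the exponents of the minimal generators; see
  \<open>min_gens_poly_on\<close>.\<close>

definition minimals :: "(nat \<Rightarrow>\<^sub>0 nat) set \<Rightarrow> (nat \<Rightarrow>\<^sub>0 nat) set" where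
  "minimals E = {a \<in> E. \<forall>b\<in>E. edvd b a \<longrightarrow> b = a}"

section \<open>Exponent vectors\<close>

lemma exps_iff: "a \<in> exps n \<longleftrightarrow> (\<forall>i. i \<notin> {1..n} \<longrightarrow> Poly_Mapping.lookup a i = 0)"
  by (auto simp: exps_def in_keys_iff)

lemma exps_add [simp]: "a + b \<in> exps n \<longleftrightarrow> a \<in> exps n \<and> b \<in> exps n"
  by (auto simp: exps_iff lookup_add)

lemma exps_single [simp]: "i \<in> {1..n} \<Longrightarrow> Poly_Mapping.single i k \<in> exps n"
  by (auto simp: exps_iff lookup_single when_def)

lemma edvd_refl [simp]: "edvd a a"
  by (simp add: edvd_def)

lemma edvd_trans: "edvd a b \<Longrightarrow> edvd b c \<Longrightarrow> edvd a c"
  by (meson edvd_def order_trans)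

lemma edvd_add [simp]: "edvd a (a + b)"
  by (simp add: edvd_def lookup_add)

lemma edvd_imp_add_diff: "edvd a b \<Longrightarrow> b = a + (b - a)"
  by (intro poly_mapping_eqI) (simp add: edvd_def lookup_add lookup_minus)

lemma edvdE:
  assumes "edvd a b"
  obtains c where "b = a + c"
  using edvd_imp_add_diff[OF assms] by blast

lemma edvd_single: "edvd (Poly_Mapping.single i k) a \<longleftrightarrow> k \<le> Poly_Mapping.lookup a i"
  by (auto simp: edvd_def lookup_single when_def)

lemma deg_add [simp]: "deg n (a + b) = deg n a + deg n b"
  by (simp add: deg_def lookup_add sum.distrib)

lemma deg_single [simp]: "i \<in> {1..n} \<Longrightarrow> deg n (Poly_Mapping.single i k) = k"
  by (simp add: deg_def lookup_single when_def)

lemma deg_eq_0: "a \<in> exps n \<Longrightarrow> deg n a = 0 \<Longrightarrow> a = 0"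
  by (intro poly_mapping_eqI) (auto simp: deg_def exps_iff)

lemma deg_pos_split:
  assumes "0 < deg n a"
  obtains i b where "i \<in> {1..n}" "a = b + Poly_Mapping.single i 1"
proof -
  from assms obtain i where i: "i \<in> {1..n}" "Poly_Mapping.lookup a i \<noteq> 0"
    unfolding deg_def by (metis gr_implies_not0 sum.not_neutral_contains_not_neutral)
  then have "edvd (Poly_Mapping.single i 1) a"
    by (simp add: edvd_single)
  then show thesis
    using that i by (metis edvdE add.commute)
qed

lemma upset_add: "a \<in> upset n A \<Longrightarrow> b \<in> exps n \<Longrightarrow> a + b \<in> upset n A"
  unfolding upset_def using edvd_trans edvd_add by fastforce

lemma upset_subset: "upset n A \<subseteq> exps n"
  by (auto simp: upset_def)

lemma subset_upset: "A \<subseteq> exps n \<Longrightarrow> A \<subseteq> upset n A"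
  unfolding upset_def using edvd_refl by blast

section \<open>Minimal elements of sets of exponents\<close>

lemma minimals_below:
  assumes "E \<subseteq> exps n" "a \<in> E"
  shows "\<exists>g\<in>minimals E. edvd g a"
  using \<open>a \<in> E\<close>
proof (induction "deg n a" arbitrary: a rule: less_induct)
  case less
  show ?case
  proof (cases "a \<in> minimals E")
    case True
    then show ?thesis
      using edvd_refl by blast
  next
    case False
    then obtain b where b: "b \<in> E" "edvd b a" "b \<noteq> a"
      using less.prems by (auto simp: minimals_def)
    then obtain c where c: "a = b + c"
      by (auto elim: edvdE)
    \<comment> \<open>The induction is on total degree: a proper divisor has strictly smaller
      degree, because a nonzero cofactor in \<open>exps n\<close> has positive degree.\<close>
    have "c \<in> exps n" "c \<noteq> 0"
      using b c assms(1) less.prems by auto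
    then have "deg n b < deg n a"
      using c deg_eq_0 by fastforce
    then show ?thesis
      using less.hyps b edvd_trans by blast
  qed
qed

text \<open>A minimal element lies above some generator, which is itself in the up-set and hence
  equal to it. So every generating set contains the minimal elements, the source of uniqueness in
  \<open>min_gens_poly_on\<close>.\<close>

lemma minimals_subset_generators:
  assumes "A \<subseteq> exps n"
  shows "minimals (upset n A) \<subseteq> A"
proof
  fix a assume a: "a \<in> minimals (upset n A)"
  then obtain m where m: "m \<in> A" "edvd m a"
    by (auto simp: minimals_def upset_def)
  then have "m \<in> upset n A"
    using subset_upset[OF assms] by blast
  then show "a \<in> A"
    using a m by (auto simp: minimals_def)
qed

lemma upset_minimals:
  "upset n (minimals (upset n A)) = upset n A"
proof
  show "upset n (minimals (upset n A)) \<subseteq> upset n A"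
    using edvd_trans by (fastforce simp: upset_def minimals_def)
  show "upset n A \<subseteq> upset n (minimals (upset n A))"
    using minimals_below[OF upset_subset] by (fastforce simp: upset_def)
qed

section \<open>Dickson's lemma\<close>

lemma monotone_subsequence:
  fixes f :: "nat \<Rightarrow> nat"
  obtains r where "strict_mono (r :: nat \<Rightarrow> nat)" "incseq (f \<circ> r)"
proof -
  obtain r where r: "strict_mono (r :: nat \<Rightarrow> nat)" "monoseq (\<lambda>k. f (r k))"
    using seq_monosub by blast
  show thesis
  proof (cases "incseq (f \<circ> r)")
    case False
    with r have dec: "decseq (f \<circ> r)"
      by (auto simp: monoseq_iff comp_def)
    \<comment> \<open>A decreasing sequence of naturals is constant from the index \<open>k\<close>
      of its minimum on, so its tail is also weakly increasing.\<close>
    define k where "k = (ARG_MIN (f \<circ> r) k. True)"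
    have "(f \<circ> r) k \<le> (f \<circ> r) j" for j
      unfolding k_def by (rule arg_min_nat_le) simp
    then have "f (r (k + j)) = f (r k)" for j
      using dec by (auto simp: decseq_def intro: order_antisym)
    then have "incseq (f \<circ> (\<lambda>j. r (k + j)))"
      by (simp add: incseq_def)
    moreover have "strict_mono (\<lambda>j. r (k + j))"
      using r by (simp add: strict_mono_def)
    ultimately show thesis
      using that by blast
  qed (use r that in blast)
qed

text \<open>The coordinates are treated one at a time: a further subsequence makes coordinate
  \<open>j\<close> increasing and keeps the earlier ones increasing.\<close>

lemma dickson_subsequence:
  fixes f :: "nat \<Rightarrow> nat \<Rightarrow>\<^sub>0 nat"
  shows "finite J \<Longrightarrow> \<exists>r. strict_mono (r :: nat \<Rightarrow> nat) \<and>
    (\<forall>i\<in>J. incseq (\<lambda>k. Poly_Mapping.lookup (f (r k)) i))"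
proof (induction rule: finite_induct)
  case empty
  show ?case
    by (auto intro: exI[of _ id] simp: strict_mono_def)
next
  case (insert j J)
  then obtain r where r: "strict_mono (r :: nat \<Rightarrow> nat)"
    "\<And>i. i \<in> J \<Longrightarrow> incseq (\<lambda>k. Poly_Mapping.lookup (f (r k)) i)"
    by blast
  obtain s where s: "strict_mono (s :: nat \<Rightarrow> nat)"
    "incseq ((\<lambda>k. Poly_Mapping.lookup (f (r k)) j) \<circ> s)"
    using monotone_subsequence by blast
  have "incseq (\<lambda>k. Poly_Mapping.lookup (f (r (s k))) i)" if "i \<in> insert j J" for i
  proof (cases "i = j")
    case True
    then show ?thesis
      using s(2) by (simp add: comp_def)
  next
    case False
    then show ?thesis
      using that r(2)[of i] s(1) by (simp add: incseq_def strict_mono_less_eq)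
  qed
  moreover have "strict_mono (\<lambda>k. r (s k))"
    using r(1) s(1) by (simp add: strict_mono_def)
  ultimately show ?case
    by blast
qed

text \<open>Minimal elements are pairwise incomparable, while an infinite set of exponent vectors in
  finitely many variables contains two distinct comparable ones.\<close>

lemma finite_minimals:
  assumes "E \<subseteq> exps n"
  shows "finite (minimals E)"
proof (rule ccontr)
  assume "infinite (minimals E)"
  then obtain f :: "nat \<Rightarrow> nat \<Rightarrow>\<^sub>0 nat" where f: "inj f" "range f \<subseteq> minimals E"
    using infinite_countable_subset by blast
  obtain r where r: "strict_mono (r :: nat \<Rightarrow> nat)"
    "\<And>i. i \<in> {1..n} \<Longrightarrow> incseq (\<lambda>k. Poly_Mapping.lookup (f (r k)) i)"
    using dickson_subsequence[OF finite_atLeastAtMost, of 1 n f] by blast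
  have mem: "f k \<in> minimals E" for k
    using f(2) by blast
  then have exps: "f k \<in> exps n" for k
    using assms by (auto simp: minimals_def)
  have "Poly_Mapping.lookup (f (r 0)) i \<le> Poly_Mapping.lookup (f (r 1)) i" for i
  proof (cases "i \<in> {1..n}")
    case True
    then show ?thesis
      using r(2)[of i] by (simp add: incseq_def)
  next
    case False
    then show ?thesis
      using exps[of "r 0"] by (simp add: exps_iff)
  qed
  then have "edvd (f (r 0)) (f (r 1))"
    by (simp add: edvd_def)
  then have "f (r 0) = f (r 1)"
    using mem by (auto simp: minimals_def)
  then show False
    using f(1) r(1) by (metis injD strict_mono_eq zero_neq_one)
qed

section \<open>Monomial ideals\<close>

lemma carrier_mpoly_ring: "carrier (mpoly_ring n) = poly_on (exps n)"
  by (auto simp: mpoly_ring_def poly_on_def exps_def)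

lemma mpoly_ring_sel [simp]:
  "x \<otimes>\<^bsub>mpoly_ring n\<^esub> y = x * y" "x \<oplus>\<^bsub>mpoly_ring n\<^esub> y = x + y"
  "\<zero>\<^bsub>mpoly_ring n\<^esub> = 0" "\<one>\<^bsub>mpoly_ring n\<^esub> = 1"
  by (simp_all add: mpoly_ring_def)

lemma mon_mult: "mon a * mon b = mon (a + b)"
  by (simp add: mon_def mult_single)

lemma mon_in_poly_on [simp]: "mon a \<in> poly_on E \<longleftrightarrow> a \<in> E"
  by (simp add: mon_def poly_on_def)

lemma poly_on_0 [simp]: "0 \<in> poly_on E"
  by (simp add: poly_on_def)

lemma poly_on_single: "a \<in> E \<Longrightarrow> Poly_Mapping.single a c \<in> poly_on E"
  by (simp add: poly_on_def)

lemma poly_on_add: "p \<in> poly_on E \<Longrightarrow> q \<in> poly_on E \<Longrightarrow> p + q \<in> poly_on E"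
  unfolding poly_on_def using keys_add[of p q] by blast

lemma poly_on_uminus: "p \<in> poly_on E \<Longrightarrow> - p \<in> poly_on E"
  by (auto simp: poly_on_def in_keys_iff)

lemma poly_on_mult:
  assumes "p \<in> poly_on E" "q \<in> poly_on F" "\<And>a b. a \<in> E \<Longrightarrow> b \<in> F \<Longrightarrow> a + b \<in> H"
  shows "p * q \<in> poly_on H"
  using assms keys_mult[of p q] by (fastforce simp: poly_on_def)

text \<open>\<open>E\<close> is recovered from its span as the set of \<open>a\<close> with
  \<open>mon a\<close> in the span. Equality of colon ideals can thus be tested on
  exponents.\<close>

lemma poly_on_inject: "(poly_on E :: 'k::field mpoly set) = poly_on F \<longleftrightarrow> E = F"
proof
  assume eq: "(poly_on E :: 'k mpoly set) = poly_on F"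
  have "a \<in> E \<longleftrightarrow> a \<in> F" for a
    using mon_in_poly_on[of a E, where 'a = 'k] mon_in_poly_on[of a F, where 'a = 'k] eq by simp
  then show "E = F"
    by blast
qed simp

lemma poly_mapping_sum_single:
  "p = (\<Sum>a\<in>Poly_Mapping.keys p. Poly_Mapping.single a (Poly_Mapping.lookup p a))"
  by (rule poly_mapping_eqI) (simp add: lookup_sum lookup_single when_def sum.delta in_keys_iff)

text \<open>A polynomial is the finite sum of its terms, so an additively closed set containing 0
  and the single terms contains the whole span.\<close>

lemma poly_on_subsetI:
  assumes "0 \<in> J" "\<And>p q. p \<in> J \<Longrightarrow> q \<in> J \<Longrightarrow> p + q \<in> J"
    "\<And>a c. a \<in> E \<Longrightarrow> Poly_Mapping.single a c \<in> J"
  shows "poly_on E \<subseteq> J"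
proof
  fix p :: "'a mpoly"
  assume p: "p \<in> poly_on E"
  have "(\<Sum>a\<in>A. Poly_Mapping.single a (Poly_Mapping.lookup p a)) \<in> J" if "finite A" "A \<subseteq> E" for A
    using that by (induction rule: finite_induct) (auto intro: assms)
  then show "p \<in> J"
    using p poly_mapping_sum_single[of p] by (metis finite_keys mem_Collect_eq poly_on_def)
qed

lemma ideal_poly_on:
  assumes "E \<subseteq> exps n" "\<And>a b. a \<in> E \<Longrightarrow> b \<in> exps n \<Longrightarrow> a + b \<in> E"
  shows "ideal (poly_on E) (mpoly_ring n :: 'k::field mpoly ring)"
proof -
  interpret cring "mpoly_ring n :: 'k mpoly ring"
    by (rule cring_mpoly_ring)
  have sub: "poly_on E \<subseteq> (poly_on (exps n) :: 'k mpoly set)"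
    using assms(1) by (auto simp: poly_on_def)
  have mult: "p * q \<in> poly_on E" if "p \<in> poly_on E" "q \<in> poly_on (exps n)" for p q :: "'k mpoly"
    using that assms(2) by (rule poly_on_mult)
  \<comment> \<open>The ring's additive inverse is abstract; identifying it with pointwise negation
    gives closure of the span under inverses.\<close>
  have neg: "\<ominus>\<^bsub>mpoly_ring n\<^esub> p = - p" if "p \<in> poly_on E" for p :: "'k mpoly"
    using that sub by (intro minus_equality) (auto simp: carrier_mpoly_ring intro: poly_on_uminus)
  have ne: "(poly_on E :: 'k mpoly set) \<noteq> {}"
    using poly_on_0 by blast
  show ?thesis
  proof (rule idealI)
    show "subgroup (poly_on E) (add_monoid (mpoly_ring n :: 'k mpoly ring))"
      using sub neg ne
      by (intro add.subgroupI) (auto simp: carrier_mpoly_ring a_inv_def[symmetric]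
          intro: poly_on_uminus poly_on_add)
  qed (use mult in \<open>auto simp: carrier_mpoly_ring ring_axioms mult.commute\<close>)
qed

lemma genideal_mon:
  assumes "A \<subseteq> exps n"
  shows "Idl\<^bsub>mpoly_ring n\<^esub> (mon ` A) = (poly_on (upset n A) :: 'k::field mpoly set)" (is "?J = _")
proof
  interpret cring "mpoly_ring n :: 'k mpoly ring"
    by (rule cring_mpoly_ring)
  have carr: "mon ` A \<subseteq> carrier (mpoly_ring n :: 'k mpoly ring)"
    using assms by (auto simp: carrier_mpoly_ring)
  show "?J \<subseteq> poly_on (upset n A)"
    using subset_upset[OF assms]
    by (intro genideal_minimal ideal_poly_on upset_subset upset_add) auto
  interpret J: ideal ?J "mpoly_ring n"
    using carr by (rule genideal_ideal)
  show "poly_on (upset n A) \<subseteq> ?J"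
  proof (rule poly_on_subsetI)
    show "0 \<in> ?J"
      using J.zero_closed by simp
    show "p + q \<in> ?J" if "p \<in> ?J" "q \<in> ?J" for p q
      using J.a_closed[OF that] by simp
    fix a and c :: 'k
    \<comment> \<open>Each term c x^a is the multiple of a generator x^m by c x^b, where a = m +
      b.\<close>
    assume "a \<in> upset n A"
    then obtain m b where m: "m \<in> A" "a = m + b" "b \<in> exps n"
      by (auto simp: upset_def elim!: edvdE)
    have "mon m \<in> ?J"
      using genideal_self[OF carr] m(1) by blast
    moreover have "Poly_Mapping.single b c \<in> carrier (mpoly_ring n)"
      using m(3) by (simp add: carrier_mpoly_ring poly_on_single)
    ultimately have "mon m * Poly_Mapping.single b c \<in> ?J"
      using J.I_r_closed by fastforce
    then show "Poly_Mapping.single a c \<in> ?J"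
      by (simp add: mon_def mult_single m(2))
  qed
qed

section \<open>Minimal monomial generators\<close>

lemma monomials_eq: "monomials n = mon ` exps n"
  by (auto simp: monomials_def mon_def exps_def)

lemma monomial_idealE:
  assumes "monomial_ideal n (I :: 'k::field mpoly set)"
  obtains A where "A \<subseteq> exps n" "I = poly_on (upset n A)"
  using assms unfolding monomial_ideal_def monomials_eq
  by (metis genideal_mon subset_image_iff)

text \<open>Resolves the description in \<open>min_gens\<close>: the minimal exponents generate, and
  every generating set of monomials contains them.\<close>

lemma min_gens_poly_on:
  assumes "A \<subseteq> exps n"
  shows "min_gens n (poly_on (upset n A)) = (mon ` minimals (upset n A) :: 'k::field mpoly set)"
    (is "_ = mon ` ?M")
  unfolding min_gens_def monomials_eq
proof (rule the_equality)
  have gen: "Idl\<^bsub>mpoly_ring n\<^esub> (mon ` B :: 'k mpoly set) = poly_on (upset n A) \<longleftrightarrow>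
    upset n B = upset n A" if "B \<subseteq> exps n" for B
    using that by (simp add: genideal_mon poly_on_inject)
  have M: "?M \<subseteq> exps n"
    using upset_subset by (auto simp: minimals_def)
  have genM: "Idl\<^bsub>mpoly_ring n\<^esub> (mon ` ?M :: 'k mpoly set) = poly_on (upset n A)"
    using gen[OF M] by (simp add: upset_minimals)
  have proper: "Idl\<^bsub>mpoly_ring n\<^esub> H \<noteq> poly_on (upset n A)" if "H \<subset> mon ` ?M" for H :: "'k mpoly set"
  proof
    assume eq: "Idl\<^bsub>mpoly_ring n\<^esub> H = poly_on (upset n A)"
    have "H \<subseteq> mon ` ?M"
      using that by blast
    then obtain B where B: "B \<subseteq> ?M" "H = mon ` B"
      unfolding subset_image_iff by blast
    then have Bn: "B \<subseteq> exps n"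
      using M by blast
    have "upset n B = upset n A"
      using eq gen[OF Bn] unfolding B(2) by blast
    then have "?M \<subseteq> B"
      using minimals_subset_generators[OF Bn] by simp
    then show False
      using that B by auto
  qed
  show "(mon ` ?M :: 'k mpoly set) \<subseteq> mon ` exps n \<and>
    Idl\<^bsub>mpoly_ring n\<^esub> (mon ` ?M :: 'k mpoly set) = poly_on (upset n A) \<and>
    (\<forall>H \<subset> mon ` ?M :: 'k mpoly set. Idl\<^bsub>mpoly_ring n\<^esub> H \<noteq> poly_on (upset n A))"
    by (intro conjI allI impI image_mono M genM proper)
  fix G :: "'k mpoly set"
  assume G: "G \<subseteq> mon ` exps n \<and> Idl\<^bsub>mpoly_ring n\<^esub> G = poly_on (upset n A) \<and>
    (\<forall>H \<subset> G. Idl\<^bsub>mpoly_ring n\<^esub> H \<noteq> poly_on (upset n A))"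
  then obtain B where B: "B \<subseteq> exps n" "G = mon ` B"
    unfolding subset_image_iff by blast
  have "upset n B = upset n A"
    using G gen[OF B(1)] unfolding B(2) by blast
  then have "?M \<subseteq> B"
    using minimals_subset_generators[OF B(1)] by simp
  then have "mon ` ?M \<subseteq> G"
    using B by blast
  then show "G = mon ` ?M"
    using G genM by blast
qed

section \<open>Powers of the maximal ideal and divisibility\<close>

lemma var_eq: "var i = mon (Poly_Mapping.single i 1)"
  by (simp add: var_def mon_def)

lemma var_pow: "var i [^]\<^bsub>mpoly_ring n\<^esub> l = mon (Poly_Mapping.single i l)"
  by (induction l) (simp_all add: nat_pow_def mpoly_ring_def var_eq mon_mult single_add[symmetric]
      , simp add: mon_def)

lemma mon_divides_iff:
  assumes "b \<in> exps n"
  shows "mon a divides\<^bsub>mpoly_ring n\<^esub> (mon b :: 'k::field mpoly) \<longleftrightarrow> edvd a b"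
proof
  assume "mon a divides\<^bsub>mpoly_ring n\<^esub> (mon b :: 'k mpoly)"
  then obtain c :: "'k mpoly" where "mon b = mon a * c"
    by (auto simp: factor_def)
  \<comment> \<open>The cofactor \<open>c\<close> may be any polynomial; every exponent of
    \<open>mon a * c\<close> still has the form \<open>a\<close> plus an exponent of
    \<open>c\<close>.\<close>
  then have "b \<in> Poly_Mapping.keys (mon a * c)"
    by (metis keys_single mon_def one_neq_zero singletonI)
  then show "edvd a b"
    using keys_mult[of "mon a" c] by (auto simp: mon_def)
next
  assume "edvd a b"
  then obtain c where "b = a + c"
    by (rule edvdE)
  with assms show "mon a divides\<^bsub>mpoly_ring n\<^esub> (mon b :: 'k mpoly)"
    by (auto simp: factor_def mon_mult carrier_mpoly_ring intro!: bexI[of _ "mon c"])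
qed

text \<open>The index n is the largest possible one. At a generator divisible by x_n, stability
  therefore allows x_n itself to be exchanged.\<close>

lemma max_var_mon:
  assumes "1 \<le> n" "a \<in> exps n" "0 < Poly_Mapping.lookup a n"
  shows "max_var n (mon a :: 'k::field mpoly) = n"
proof -
  have "n \<in> {j \<in> {1..n}. var j divides\<^bsub>mpoly_ring n\<^esub> (mon a :: 'k mpoly)}"
    using assms by (simp add: var_eq mon_divides_iff edvd_single)
  then show ?thesis
    unfolding max_var_def by (intro cSup_eq_maximum) auto
qed

section \<open>Products of monomial spans and powers of the maximal ideal\<close>

lemma ideal_prod_poly_on:
  "ideal_prod (mpoly_ring n) (poly_on E) (poly_on F) =
    (poly_on {a + b | a b. a \<in> E \<and> b \<in> F} :: 'k::field mpoly set)" (is "?P = poly_on ?H")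
proof
  show "?P \<subseteq> poly_on ?H"
  proof
    fix p :: "'k mpoly"
    assume "p \<in> ?P"
    then show "p \<in> poly_on ?H"
    proof induction
      case (prod i j)
      show ?case
        unfolding mpoly_ring_sel by (rule poly_on_mult[OF prod]) blast
    next
      case (sum s t)
      then show ?case
        by (simp add: poly_on_add)
    qed
  qed
  show "poly_on ?H \<subseteq> ?P"
  proof (rule poly_on_subsetI)
    show "0 \<in> ?P"
      using ideal_prod.prod[of 0 "poly_on E" 0 "poly_on F" "mpoly_ring n"] by simp
    show "p + q \<in> ?P" if "p \<in> ?P" "q \<in> ?P" for p q
      using ideal_prod.sum[OF that] by simp
    fix a and c :: 'k
    assume "a \<in> ?H"
    then obtain e f where "a = e + f" "e \<in> E" "f \<in> F"
      by blast
    \<comment> \<open>A single term of the span is one product of a term over \<open>E\<close> and a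
      monomial over \<open>F\<close>; the coefficient goes into the first factor.\<close>
    then show "Poly_Mapping.single a c \<in> ?P"
      using ideal_prod.prod[of "Poly_Mapping.single e c" "poly_on E" "mon f" "poly_on F" "mpoly_ring n"]
      by (simp add: mon_def mult_single poly_on_single)
  qed
qed

lemma max_ideal_eq: "max_ideal n = (poly_on {a \<in> exps n. 1 \<le> deg n a} :: 'k::field mpoly set)"
proof -
  have "upset n ((\<lambda>i. Poly_Mapping.single i 1) ` {1..n}) = {a \<in> exps n. 1 \<le> deg n a}"
  proof
    show "{a \<in> exps n. 1 \<le> deg n a} \<subseteq> upset n ((\<lambda>i. Poly_Mapping.single i 1) ` {1..n})"
    proof
      fix a assume a: "a \<in> {a \<in> exps n. 1 \<le> deg n a}"
      then have "0 < deg n a"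
        by simp
      then obtain i b where "i \<in> {1..n}" "a = b + Poly_Mapping.single i 1"
        by (rule deg_pos_split)
      with a show "a \<in> upset n ((\<lambda>i. Poly_Mapping.single i 1) ` {1..n})"
        by (auto simp: upset_def edvd_single lookup_add intro!: bexI[of _ i])
    qed
  qed (auto simp: upset_def elim!: edvdE)
  moreover have "(var ` {1..n} :: 'k mpoly set) = mon ` (\<lambda>i. Poly_Mapping.single i 1) ` {1..n}"
    by (auto simp: var_eq)
  moreover have "(\<lambda>i. Poly_Mapping.single i 1) ` {1..n} \<subseteq> exps n"
    by auto
  ultimately show ?thesis
    unfolding max_ideal_def by (simp only: genideal_mon)
qed

text \<open>A monomial of degree at least k + 1 splits off one variable and leaves degree at least
  k. For k = 0 the power is the unit of the monoid of ideals, the whole ring, and the degree bound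
  is vacuous.\<close>

lemma max_ideal_pow:
  "max_ideal n [^]\<^bsub>ideals_set (mpoly_ring n)\<^esub> (k::nat) =
    (poly_on {a \<in> exps n. k \<le> deg n a} :: 'k::field mpoly set)"
proof (induction k)
  case 0
  show ?case
    by (simp add: nat_pow_def ideals_set_def carrier_mpoly_ring)
next
  case (Suc k)
  have "{a + b | a b. a \<in> {a \<in> exps n. k \<le> deg n a} \<and> b \<in> {a \<in> exps n. 1 \<le> deg n a}} =
    {a \<in> exps n. Suc k \<le> deg n a}" (is "?L = ?R")
  proof
    show "?R \<subseteq> ?L"
    proof
      fix a assume a: "a \<in> ?R"
      then have "0 < deg n a"
        by simp
      then obtain i b where i: "i \<in> {1..n}" "a = b + Poly_Mapping.single i 1"
        by (rule deg_pos_split)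
      with a show "a \<in> ?L"
        by (intro CollectI exI[of _ b] exI[of _ "Poly_Mapping.single i 1"]) auto
    qed
  qed auto
  then have "ideal_prod (mpoly_ring n) (poly_on {a \<in> exps n. k \<le> deg n a}) (max_ideal n) =
      (poly_on {a \<in> exps n. Suc k \<le> deg n a} :: 'k mpoly set)"
    by (simp add: max_ideal_eq ideal_prod_poly_on)
  then show ?case
    using Suc by (simp add: nat_pow_def ideals_set_def)
qed

section \<open>Saturation of stable ideals\<close>

text \<open>Multiplication by a monomial shifts exponents without cancellation, so membership of the
  product in a span can be read off term by term.\<close>

lemma lookup_times_mon: "Poly_Mapping.lookup (f * mon t) (a + t) = Poly_Mapping.lookup f a"
proof -
  have "Poly_Mapping.lookup (mon t * f) (t + a) = Poly_Mapping.lookup f a"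
    by (simp add: lookup_mult mon_def lookup_single when_mult)
  then show ?thesis
    by (simp add: mult.commute add.commute)
qed

text \<open>Stability speaks only of minimal generators; this extends the exchange of x_n for x_i to
  every monomial of the ideal. A generator g below a + e_n either divides x^a already, or uses the
  full power of x_n, and then the exchange is made in g and multiplied by the cofactor.\<close>

lemma stable_exchange:
  assumes "1 \<le> n" "stable_ideal n (poly_on (upset n A) :: 'k::field mpoly set)" "A \<subseteq> exps n"
    and mem: "a + Poly_Mapping.single n 1 \<in> upset n A" and i: "i \<in> {1..n}"
  shows "a + Poly_Mapping.single i 1 \<in> upset n A"
proof (cases "i = n")
  case False
  let ?E = "upset n A"
  have a: "a \<in> exps n"
    using mem by (auto simp: upset_def)
  obtain g where g: "g \<in> minimals ?E" "edvd g (a + Poly_Mapping.single n 1)"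
    using minimals_below[OF upset_subset mem] by blast
  have gE: "g \<in> ?E" "g \<in> exps n"
    using g(1) upset_subset by (auto simp: minimals_def)
  show ?thesis
  proof (cases "edvd g a")
    case True
    then show ?thesis
      using a i gE by (metis edvdE exps_add exps_single upset_add)
  next
    case nd: False
    have gn: "Poly_Mapping.lookup g n = Suc (Poly_Mapping.lookup a n)"
    proof (rule ccontr)
      \<comment> \<open>The vectors a and a + e_n differ only at n, so a smaller exponent of g there
        would make g divide x^a.\<close>
      assume *: "\<not> ?thesis"
      have "Poly_Mapping.lookup g j \<le> Poly_Mapping.lookup a j" for j
        using g(2)[unfolded edvd_def, rule_format, of j] *
        by (auto simp: lookup_add lookup_single when_def split: if_splits)
      with nd show False
        by (simp add: edvd_def)
    qed
    have mv: "max_var n (mon g :: 'k mpoly) = n"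
      using assms(1) gE gn by (intro max_var_mon) auto
    have "mon g \<in> (min_gens n (poly_on ?E) :: 'k mpoly set)"
      using g(1) by (simp add: min_gens_poly_on[OF assms(3)])
    moreover have "i \<in> {1..<n}"
      using i False by auto
    ultimately obtain v :: "'k mpoly" where v: "v \<in> poly_on ?E" "v * var n = var i * mon g"
      using assms(2) mv unfolding stable_ideal_def by fastforce
    \<comment> \<open>The witness \<open>v\<close> is only known to be a polynomial in the ideal.
      Comparing exponents in the product yields an exponent \<open>b\<close> of \<open>v\<close>,
      namely that of x_i x^g / x_n.\<close>
    have "Poly_Mapping.single i 1 + g \<in> Poly_Mapping.keys (v * var n)"
      unfolding v(2) by (simp add: var_eq mon_mult) (simp add: mon_def)
    then obtain b where b: "Poly_Mapping.single i 1 + g = b + Poly_Mapping.single n 1"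
      "b \<in> Poly_Mapping.keys v"
      using keys_mult[of v "var n"] by (auto simp: var_def)
    have "b \<in> ?E"
      using b v by (auto simp: poly_on_def)
    obtain c where c: "a + Poly_Mapping.single n 1 = g + c"
      using g(2) by (rule edvdE)
    have "(a + Poly_Mapping.single i 1) + Poly_Mapping.single n 1 =
        Poly_Mapping.single i 1 + (a + Poly_Mapping.single n 1)"
      by (simp only: ac_simps)
    also have "\<dots> = (Poly_Mapping.single i 1 + g) + c"
      by (simp only: c add.assoc)
    also have "\<dots> = (b + c) + Poly_Mapping.single n 1"
      unfolding b(1) by (simp only: ac_simps)
    finally have *: "a + Poly_Mapping.single i 1 = b + c"
      by (rule add_right_imp_eq)
    then have "c \<in> exps n"
      using a i by (metis exps_add exps_single)
    with \<open>b \<in> ?E\<close> show ?thesis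
      unfolding * by (rule upset_add)
  qed
qed (use mem in simp)

text \<open>The k factors x_n are traded one by one for variables of x^b; the surplus of x^b is
  absorbed at k = 0, where the ideal property suffices.\<close>

lemma stable_exchange_deg:
  assumes "1 \<le> n" "stable_ideal n (poly_on (upset n A) :: 'k::field mpoly set)" "A \<subseteq> exps n"
  shows "a + Poly_Mapping.single n k \<in> upset n A \<Longrightarrow> b \<in> exps n \<Longrightarrow> k \<le> deg n b \<Longrightarrow>
    a + b \<in> upset n A"
proof (induction k arbitrary: a b)
  case 0
  then show ?case
    by (simp add: upset_add)
next
  case (Suc k)
  then have "0 < deg n b"
    by simp
  then obtain i c where i: "i \<in> {1..n}" "b = c + Poly_Mapping.single i 1"
    by (rule deg_pos_split)
  have "a + Poly_Mapping.single n (Suc k) =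
      (a + Poly_Mapping.single n k) + Poly_Mapping.single n 1"
    by (simp add: add.assoc single_add[symmetric])
  with Suc.prems(1) have "(a + Poly_Mapping.single n k) + Poly_Mapping.single n 1 \<in> upset n A"
    by (simp only:)
  then have "(a + Poly_Mapping.single n k) + Poly_Mapping.single i 1 \<in> upset n A"
    using i(1) by (rule stable_exchange[OF assms])
  \<comment> \<open>The variable just obtained is moved into the base, leaving k factors x_n to
    trade for the rest c of b.\<close>
  then have *: "(a + Poly_Mapping.single i 1) + Poly_Mapping.single n k \<in> upset n A"
    by (simp only: ac_simps)
  have "c \<in> exps n" "k \<le> deg n c"
    using Suc.prems(2,3) i by auto
  with * have "(a + Poly_Mapping.single i 1) + c \<in> upset n A"
    by (rule Suc.IH)
  then show ?case
    unfolding i(2) by (simp only: ac_simps)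
qed

text \<open>The right-hand side is I : x_n^k. It contains I : m^k because x_n^k lies in m^k; the
  converse is the exchange against all monomials of degree at least k.\<close>

lemma colon_ideal_stable:
  assumes "1 \<le> n" "stable_ideal n (poly_on (upset n A) :: 'k::field mpoly set)" "A \<subseteq> exps n"
  shows "colon_ideal (mpoly_ring n) (poly_on (upset n A))
      (max_ideal n [^]\<^bsub>ideals_set (mpoly_ring n)\<^esub> (k::nat)) =
    (poly_on {a. a + Poly_Mapping.single n k \<in> upset n A} :: 'k mpoly set)" (is "?C = poly_on ?P")
proof
  show "?C \<subseteq> poly_on ?P"
  proof
    fix f :: "'k mpoly"
    assume "f \<in> ?C"
    then have *: "f * mon (Poly_Mapping.single n k) \<in> poly_on (upset n A)"
      using assms(1) by (simp add: colon_ideal_def max_ideal_pow)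
    show "f \<in> poly_on ?P"
      unfolding poly_on_def
    proof safe
      fix a assume "a \<in> Poly_Mapping.keys f"
      then have "a + Poly_Mapping.single n k \<in>
          Poly_Mapping.keys (f * mon (Poly_Mapping.single n k))"
        by (simp add: in_keys_iff lookup_times_mon)
      then show "a + Poly_Mapping.single n k \<in> upset n A"
        using * by (auto simp: poly_on_def)
    qed
  qed
  show "poly_on ?P \<subseteq> ?C"
  proof
    fix f :: "'k mpoly"
    assume f: "f \<in> poly_on ?P"
    have "?P \<subseteq> exps n"
      using upset_subset[of n A] by auto
    then have "f \<in> poly_on (exps n)"
      using f by (auto simp: poly_on_def)
    moreover have "f * g \<in> poly_on (upset n A)" if "g \<in> poly_on {a \<in> exps n. k \<le> deg n a}" for g
      using f that by (rule poly_on_mult) (auto intro: stable_exchange_deg[OF assms])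
    ultimately show "f \<in> ?C"
      by (simp add: colon_ideal_def max_ideal_pow carrier_mpoly_ring)
  qed
qed

theorem proposition2p7:
  fixes n :: nat and I :: "'k::field mpoly set"
  assumes "n \<ge> 1" and "stable_ideal n I"
  shows "sat n I =
    Sup {l. \<exists>u\<in>min_gens n I. (var n [^]\<^bsub>mpoly_ring n\<^esub> l) divides\<^bsub>mpoly_ring n\<^esub> u}"
proof -
  obtain A where A: "A \<subseteq> exps n" "I = poly_on (upset n A)"
    using assms(2) monomial_idealE unfolding stable_ideal_def by blast
  let ?E = "upset n A"
  let ?e = "Poly_Mapping.single n"
  \<comment> \<open>\<open>P k\<close> is the set of exponents of I : m^k.\<close>
  define P where "P k = {a. a + ?e k \<in> ?E}" for k
  define X where "X = {l. \<exists>g\<in>minimals ?E. l \<le> Poly_Mapping.lookup g n}"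
  have ME: "minimals ?E \<subseteq> exps n"
    using upset_subset by (auto simp: minimals_def)
  have X: "{l. \<exists>u\<in>min_gens n I. (var n [^]\<^bsub>mpoly_ring n\<^esub> l) divides\<^bsub>mpoly_ring n\<^esub> u} = X"
    using ME unfolding X_def A(2) min_gens_poly_on[OF A(1)] var_pow
    by (auto simp: mon_divides_iff edvd_single subset_iff)
  have "X = (\<Union>g\<in>minimals ?E. {..Poly_Mapping.lookup g n})"
    by (auto simp: X_def)
  \<comment> \<open>Finitely many generators contribute one initial segment each; finiteness makes
    \<open>Sup X\<close> an upper bound of \<open>X\<close>.\<close>
  then have finX: "finite X"
    using finite_minimals[OF upset_subset] by simp
  have sat: "sat n I = (LEAST k. P k = P (k + 1))"
    using assms A(1) unfolding sat_def A(2) P_def by (simp only: colon_ideal_stable poly_on_inject)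
  have stationary: "P k = P (k + 1)" if k: "Sup X \<le> k" for k
  proof
    have split: "a + ?e (k + 1) = (a + ?e k) + ?e 1" for a
      by (simp add: add.assoc single_add[symmetric])
    show "P k \<subseteq> P (k + 1)"
      unfolding P_def split using assms(1) by (auto intro: upset_add)
    show "P (k + 1) \<subseteq> P k"
    proof
      fix a assume "a \<in> P (k + 1)"
      then have a: "a + ?e (k + 1) \<in> ?E"
        by (simp add: P_def)
      then obtain g where g: "g \<in> minimals ?E" "edvd g (a + ?e (k + 1))"
        using minimals_below[OF upset_subset] by blast
      have "Poly_Mapping.lookup g n \<le> Sup X"
        using g(1) finX by (intro cSup_upper) (auto simp: X_def)
      \<comment> \<open>At n the exponent of \<open>g\<close> is at most \<open>Sup X\<close>, hence
        at most \<open>k\<close>; at the other indices both bounds agree.\<close>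
      then have "edvd g (a + ?e k)"
        using g(2) k unfolding edvd_def
        by (auto simp: lookup_add lookup_single when_def split: if_splits)
      moreover have "a + ?e k \<in> exps n"
        using a assms(1) by (auto simp: upset_def)
      moreover have "g \<in> ?E"
        using g(1) by (simp add: minimals_def)
      ultimately show "a \<in> P k"
        unfolding P_def by (metis edvdE exps_add mem_Collect_eq upset_add)
    qed
  qed
  have bound: "Sup X \<le> k" if eq: "P k = P (k + 1)" for k
  \<comment> \<open>\<open>X\<close> is empty exactly when there are no generators, that is, for the
    zero ideal; then the supremum is 0 by convention.\<close>
  proof (cases "X = {}")
    case False
    then show ?thesis
    proof (rule cSup_least)
      fix l assume "l \<in> X"
      then obtain g where g: "g \<in> minimals ?E" "l \<le> Poly_Mapping.lookup g n"
        by (auto simp: X_def)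
      show "l \<le> k"
      proof (rule ccontr)
        assume "\<not> l \<le> k"
        then have "edvd (?e (k + 1)) g"
          using g(2) by (simp add: edvd_single)
        then obtain a where a: "g = a + ?e (k + 1)"
          by (metis edvdE add.commute)
        \<comment> \<open>As the chain is stationary at \<open>k\<close>, the proper divisor a + k
          e_n of \<open>g\<close> also lies in \<open>?E\<close>. Minimality of \<open>g\<close>
          then forces e_n = 0.\<close>
        then have "a \<in> P (k + 1)"
          using g(1) by (simp add: P_def minimals_def)
        then have "a + ?e k \<in> ?E"
          using eq by (auto simp: P_def)
        moreover have split: "g = (a + ?e k) + ?e 1"
          by (simp add: a add.assoc single_add[symmetric])
        ultimately have "a + ?e k = g"
          using g(1) edvd_add by (auto simp: minimals_def)
        then have "?e (Suc 0) = 0"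
          using split by simp
        then have "Poly_Mapping.lookup (?e (Suc 0)) n = 0"
          by (simp only: lookup_zero)
        then show False
          by simp
      qed
    qed
  qed (simp add: Sup_nat_def)
  show ?thesis
    unfolding sat X using stationary[OF order_refl] bound by (rule Least_equality)
qed

end
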